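(* Let $d\geq 5$ and let $\mathcal{R}=\{A_0=I,A_1,\ldots,A_d\}$ be a symmetric $d$-class association scheme. If every triple $\{A_i,A_j,A_k\}$ of three distinct nontrivial relations ($i,j,k\in\{1,\ldots,d\}$) fuses, then $\mathcal{R}$ is amorphic.
   Context: Symmetric $d$-class association scheme: for a finite set $X$, a collection $\mathcal{R}=\{A_0,A_1,\ldots,A_d\}$ of nonzero $X\times X$ $\{0,1\}$-matrices such that $A_0=I$; $\sum_{i=0}^d A_i=J$ (all-one matrix); $A_i^\top=A_i$ for all $i$; and there are numbers $p_{ij}^h$ with $A_iA_j=\sum_{h=0}^d p_{ij}^hA_h$ for all $i,j$. The matrices $A_1,\ldots,A_d$ are the (nontrivial) relations. Fusion: for a partition $\pi=\{\pi(0),\pi(1),\ldots,\pi(d')\}$ of $\{0,1,\ldots,d\}$ with $\pi(0)=\{0\}$, let $\mathcal{R}_\pi=\{\sum_{i\in\pi(s)}A_i : 0\le s\le d'\}$. If $\mathcal{R}_\pi$ is an association scheme it is called a fusion scheme of $\mathcal{R}$. $\mathcal{R}$ is amorphic if $\mathcal{R}_\pi$ is a fusion scheme for every such partition $\pi$. A set $\{A_i : i\in \mathcal{I}\}$ of relations ($\mathcal{I}\subseteq\{1,\ldots,d\}$) fuses if $\mathcal{R}_\pi$ is a fusion scheme for the partition $\pi$ whose blocks are $\mathcal{I}$ and the singletons $\{i\}$, $i\in\{0,\ldots,d\}\setminus\mathcal{I}$. *)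

theory Defs
  imports "HOL-Analysis.Analysis" "HOL-Library.Disjoint_Sets"
begin

text \<open>
  The finite set \<open>X\<close> is the universe of a type \<open>'x\<close> of class \<open>finite\<close>.  The relations are
  indexed by an arbitrary finite set \<open>I\<close> with a distinguished index \<open>z\<close> for the identity relation,
  so that a scheme can be indexed by \<open>{0..d}\<close> and its fusions by the blocks of a partition
  of \<open>{0..d}\<close>.
\<close>

definition symmetric_scheme :: "'i set \<Rightarrow> 'i \<Rightarrow> ('i \<Rightarrow> real ^ 'x ^ 'x) \<Rightarrow> bool" where
  "symmetric_scheme I z A \<longleftrightarrow>
     finite I \<and> z \<in> I \<and>
     (\<forall>i\<in>I. A i \<noteq> 0 \<and> (\<forall>x y. A i $ x $ y \<in> {0, 1})) \<and>
     A z = mat 1 \<and>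
     (\<Sum>i\<in>I. A i) = (\<chi> x y. 1) \<and>
     (\<forall>i\<in>I. transpose (A i) = A i) \<and>
     (\<exists>p :: 'i \<Rightarrow> 'i \<Rightarrow> 'i \<Rightarrow> real.
        \<forall>i\<in>I. \<forall>j\<in>I. A i ** A j = (\<Sum>h\<in>I. p i j h *\<^sub>R A h))"

abbreviation symmetric_class_scheme :: "nat \<Rightarrow> (nat \<Rightarrow> real ^ 'x ^ 'x) \<Rightarrow> bool" where
  "symmetric_class_scheme d A \<equiv> symmetric_scheme {0..d} 0 A"

definition fusion_partition :: "nat \<Rightarrow> nat set set \<Rightarrow> bool" where
  "fusion_partition d P \<longleftrightarrow> partition_on {0..d} P \<and> {0} \<in> P"

definition is_fusion_scheme :: "(nat \<Rightarrow> real ^ 'x ^ 'x) \<Rightarrow> nat set set \<Rightarrow> bool" where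
  "is_fusion_scheme A P \<longleftrightarrow> symmetric_scheme P {0} (\<lambda>B. \<Sum>i\<in>B. A i)"

definition amorphic :: "nat \<Rightarrow> (nat \<Rightarrow> real ^ 'x ^ 'x) \<Rightarrow> bool" where
  "amorphic d A \<longleftrightarrow> (\<forall>P. fusion_partition d P \<longrightarrow> is_fusion_scheme A P)"

definition fuses :: "nat \<Rightarrow> (nat \<Rightarrow> real ^ 'x ^ 'x) \<Rightarrow> nat set \<Rightarrow> bool" where
  "fuses d A I \<longleftrightarrow> is_fusion_scheme A (insert I ((\<lambda>i. {i}) ` ({0..d} - I)))"

end

theory Submission
  imports Defs
begin

text \<open>
  For nontrivial \<open>a\<close>, \<open>b\<close> the fusion of a triple that avoids \<open>a\<close> and \<open>b\<close> forces the intersection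
  number \<open>p a b h\<close> to agree on that triple.  As \<open>d \<ge> 5\<close>, any two indices outside \<open>{0, a, b}\<close> lie in
  such a triple, so \<open>p a b h\<close> does not depend on \<open>h \<notin> {0, a, b}\<close>.  This uniformity already
  determines all products of relations from the valencies and three constants.

  Write \<open>k\<close> for the valencies.  The quantity \<open>p a b h / (k a * k b)\<close> is invariant under all
  permutations of \<open>a\<close>, \<open>b\<close>, \<open>h\<close>, because multiplying it by \<open>k a * k b * k h\<close> gives the number of
  triangles with sides \<open>a\<close>, \<open>b\<close>, \<open>h\<close>, per point.  Together with uniformity, this makes it a constant
  \<open>l\<close> on triples of distinct indices, and a value \<open>m a\<close> on \<open>(a, a, h)\<close> for all \<open>h \<noteq> a\<close>.  Summing
  \<open>p a b h\<close> over \<open>b\<close> gives, for all \<open>a \<noteq> h\<close>,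
  \<open>(m a - l) * k a + (m h - l) * k h = 1 - l * K\<close>, where \<open>K\<close> is the sum of the nontrivial
  valencies.  With at least three nontrivial relations, \<open>(m a - l) * k a\<close> is therefore the same
  number \<open>e\<close> for every \<open>a\<close>.  In matrix form the result is
  \<open>A a ** A b = l k a k b (J - I) + e (k b A a + k a A b)\<close>, to which
  \<open>k a I + e k a (J - I) + t A a\<close> is added when \<open>a = b\<close> (lemma \<open>p_normal_form\<close>).

  This formula is additive: it is bilinear in the pairs \<open>(A a, k a)\<close>, apart from a diagonal term
  that is linear in the pair.  Hence sums of the relations over disjoint blocks multiply by the
  same formula, with the total valencies of the blocks, and every partition yields a scheme.
\<close>

section \<open>Intersection numbers and valencies\<close>

locale scheme_with_numbers =
  fixes I :: "'i set" and z :: 'i and A :: "'i \<Rightarrow> real ^ 'x ^ 'x"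
    and p :: "'i \<Rightarrow> 'i \<Rightarrow> 'i \<Rightarrow> real"
  assumes scheme: "symmetric_scheme I z A"
    and mult_expand: "\<And>i j. i \<in> I \<Longrightarrow> j \<in> I \<Longrightarrow> A i ** A j = (\<Sum>h\<in>I. p i j h *\<^sub>R A h)"
begin

lemma finite_I: "finite I"
  and z_in_I: "z \<in> I"
  and A_z: "A z = mat 1"
  using scheme by (auto simp: symmetric_scheme_def)

lemma entry_01: "i \<in> I \<Longrightarrow> A i $ x $ y = 0 \<or> A i $ x $ y = 1"
  using scheme by (auto simp: symmetric_scheme_def)

lemma entry_sym: "i \<in> I \<Longrightarrow> A i $ x $ y = A i $ y $ x"
proof -
  assume "i \<in> I"
  then have "transpose (A i) = A i" using scheme by (simp add: symmetric_scheme_def)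
  then have "transpose (A i) $ y $ x = A i $ y $ x" by simp
  then show ?thesis by (simp add: transpose_def)
qed

lemma entry_sum: "(\<Sum>i\<in>I. A i $ x $ y) = 1"
proof -
  have "(\<Sum>i\<in>I. A i) $ x $ y = 1"
    using scheme by (simp add: symmetric_scheme_def)
  then show ?thesis by simp
qed

text \<open>
  Exactly one relation holds between two points, so a linear combination of the relations can be
  evaluated at a pair of points by naming the relation of that pair.
\<close>

lemma entry_unique:
  assumes "h \<in> I" "A h $ x $ y = 1" "i \<in> I"
  shows "A i $ x $ y = (if i = h then 1 else 0)"
proof (cases "i = h")
  case False
  have "A i $ x $ y + A h $ x $ y \<le> (\<Sum>g\<in>I. A g $ x $ y)"
    using sum_mono2[of I "{i, h}" "\<lambda>g. A g $ x $ y"] finite_I assms entry_01[of _ x y] False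
    by fastforce
  then show ?thesis
    using entry_sum[of x y] assms entry_01[of i x y] False by auto
qed (use assms in simp)

lemma relation_exists: "\<exists>h\<in>I. A h $ x $ y = 1"
proof (rule ccontr)
  assume "\<not> ?thesis"
  then have "(\<Sum>i\<in>I. A i $ x $ y) = 0" using entry_01 by (intro sum.neutral) blast
  then show False using entry_sum[of x y] by simp
qed

lemma relation_nonempty:
  assumes "h \<in> I" shows "\<exists>x y. A h $ x $ y = 1"
proof -
  have "A h \<noteq> 0" using scheme assms by (simp add: symmetric_scheme_def)
  then obtain x y where "A h $ x $ y \<noteq> 0" by (auto simp: vec_eq_iff)
  with entry_01[OF assms] show ?thesis by blast
qed

lemma product_entry:
  assumes "i \<in> I" "j \<in> I" "h \<in> I" "A h $ x $ y = 1"
  shows "(A i ** A j) $ x $ y = p i j h"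
proof -
  have "(A i ** A j) $ x $ y = (\<Sum>g\<in>I. p i j g * A g $ x $ y)"
    using assms by (simp add: mult_expand)
  also have "\<dots> = (\<Sum>g\<in>I. if g = h then p i j g else 0)"
    using entry_unique[OF assms(3,4)] by (intro sum.cong) auto
  finally show ?thesis using assms finite_I by simp
qed

lemma p_commute:
  assumes "i \<in> I" "j \<in> I" "h \<in> I"
  shows "p i j h = p j i h"
proof -
  obtain x y where xy: "A h $ x $ y = 1" using relation_nonempty assms by blast
  then have yx: "A h $ y $ x = 1" using entry_sym[OF assms(3), of x y] by simp
  have "(A i ** A j) $ x $ y = (A j ** A i) $ y $ x"
    unfolding matrix_matrix_mult_def
    using entry_sym[OF assms(1)] entry_sym[OF assms(2)]
    by (auto simp: mult.commute intro!: sum.cong)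
  then show ?thesis using product_entry assms xy yx by metis
qed

lemma p_left_z:
  assumes "i \<in> I" "h \<in> I"
  shows "p z i h = (if i = h then 1 else 0)"
proof -
  obtain x y where xy: "A h $ x $ y = 1" using relation_nonempty assms by blast
  have "p z i h = (A z ** A i) $ x $ y"
    using product_entry[OF z_in_I assms xy] by simp
  also have "\<dots> = A i $ x $ y" by (simp add: A_z)
  finally show ?thesis using entry_unique[OF assms(2) xy assms(1)] by simp
qed

text \<open>The entries of \<open>A i ** A i\<close> on the diagonal are the row sums of \<open>A i\<close>; see \<open>row_sum\<close>.\<close>

definition valency :: "'i \<Rightarrow> real" where
  "valency i = p i i z"

lemma A_z_diag: "A z $ x $ x = 1"
  by (simp add: A_z mat_def)

lemma row_sum:
  assumes "i \<in> I" shows "(\<Sum>y\<in>UNIV. A i $ x $ y) = valency i"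
proof -
  have "valency i = (A i ** A i) $ x $ x"
    unfolding valency_def using product_entry[OF assms assms z_in_I A_z_diag] by simp
  also have "\<dots> = (\<Sum>y\<in>UNIV. A i $ x $ y * A i $ y $ x)"
    by (simp add: matrix_matrix_mult_def)
  also have "\<dots> = (\<Sum>y\<in>UNIV. A i $ x $ y)"
  proof (rule sum.cong[OF refl])
    fix y
    show "A i $ x $ y * A i $ y $ x = A i $ x $ y"
      using entry_01[OF assms, of x y] entry_sym[OF assms, of x y] by auto
  qed
  finally show ?thesis by simp
qed

lemma valency_pos:
  assumes "i \<in> I" shows "valency i > 0"
proof -
  obtain x y where "A i $ x $ y = 1" using relation_nonempty assms by blast
  moreover have "\<And>y. 0 \<le> A i $ x $ y" using entry_01[OF assms] by (metis order_refl zero_le_one)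
  ultimately have "0 < (\<Sum>y\<in>UNIV. A i $ x $ y)"
    by (intro sum_pos2[of _ y]) auto
  then show ?thesis by (simp add: row_sum[OF assms])
qed

text \<open>
  Fix \<open>x\<close>, \<open>y\<close> in relation \<open>h\<close>.  Each of the \<open>valency a\<close> neighbours \<open>w\<close> of \<open>x\<close> is in exactly one
  relation \<open>b\<close> to \<open>y\<close>.
\<close>

lemma sum_p:
  assumes "a \<in> I" "h \<in> I"
  shows "(\<Sum>b\<in>I. p a b h) = valency a"
proof -
  obtain x y where xy: "A h $ x $ y = 1" using relation_nonempty assms by blast
  have "(\<Sum>b\<in>I. p a b h) = (\<Sum>b\<in>I. \<Sum>w\<in>UNIV. A a $ x $ w * A b $ w $ y)"
    using product_entry[OF assms(1) _ assms(2) xy]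
    by (intro sum.cong) (auto simp: matrix_matrix_mult_def)
  also have "\<dots> = (\<Sum>w\<in>UNIV. A a $ x $ w * (\<Sum>b\<in>I. A b $ w $ y))"
    by (subst sum.swap) (simp add: sum_distrib_left)
  finally show ?thesis using row_sum[OF assms(1)] by (simp add: entry_sum)
qed

text \<open>
  Multiplied by \<open>CARD('x)\<close>, both sides count the triangles with sides \<open>i\<close>, \<open>j\<close>, \<open>h\<close>: this count
  is the trace of \<open>A i ** A j ** A h\<close>, which is invariant under cyclic rotation.
\<close>

lemma p_triple:
  assumes "i \<in> I" "j \<in> I" "h \<in> I"
  shows "valency h * p i j h = valency j * p h i j"
proof -
  have tr: "trace ((A i ** A j) ** A h) = real CARD('x) * (valency h * p i j h)"
    if "i \<in> I" "j \<in> I" "h \<in> I" for i j h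
  proof -
    have "trace ((A i ** A j) ** A h)
        = (\<Sum>x\<in>UNIV. \<Sum>y\<in>UNIV. (A i ** A j) $ x $ y * A h $ y $ x)"
      unfolding trace_def matrix_matrix_mult_def[of "A i ** A j"] by simp
    also have "\<dots> = (\<Sum>x\<in>UNIV. \<Sum>y\<in>UNIV. p i j h * A h $ x $ y)"
    proof (intro sum.cong refl)
      fix x y
      show "(A i ** A j) $ x $ y * A h $ y $ x = p i j h * A h $ x $ y"
        using entry_01[OF that(3), of x y] entry_sym[OF that(3), of x y]
          product_entry[OF that, of x y] by auto
    qed
    also have "\<dots> = real CARD('x) * (valency h * p i j h)"
      by (simp add: sum_distrib_left[symmetric] row_sum[OF that(3)])
    finally show ?thesis .
  qed
  have "trace ((A i ** A j) ** A h) = trace ((A h ** A i) ** A j)"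
    by (metis matrix_mul_assoc trace_mul_sym)
  then show ?thesis using tr[of i j h] tr[of h i j] assms by simp
qed

section \<open>Fusion by a partition\<close>

text \<open>
  The sums of the relations over the blocks inherit every axiom except closure under products.
  The product of two block sums takes the value \<open>\<Sum>a\<in>S. \<Sum>b\<in>T. p a b h\<close> at a pair of points in
  relation \<open>h\<close>, so closure means that this number depends only on the block of \<open>h\<close>.
\<close>

lemma fusion_scheme_if_block_sums_constant:
  assumes P: "partition_on I P" and zP: "{z} \<in> P"
    and const: "\<And>S T B h h'. \<lbrakk>S \<in> P; T \<in> P; B \<in> P; h \<in> B; h' \<in> B\<rbrakk>
       \<Longrightarrow> (\<Sum>a\<in>S. \<Sum>b\<in>T. p a b h) = (\<Sum>a\<in>S. \<Sum>b\<in>T. p a b h')"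
  shows "symmetric_scheme P {z} (\<lambda>B. \<Sum>i\<in>B. A i)"
proof -
  have sub: "B \<subseteq> I" if "B \<in> P" for B using P that by (auto simp: partition_on_def)
  have fin: "finite B" if "B \<in> P" for B using sub[OF that] finite_I finite_subset by blast
  have finP: "finite P" using P finite_I by (rule finite_elements[rotated])
  have ent: "(\<Sum>i\<in>B. A i) $ x $ y = (if h \<in> B then 1 else 0)"
    if "B \<in> P" "h \<in> I" "A h $ x $ y = 1" for B h x y
  proof -
    have "(\<Sum>i\<in>B. A i) $ x $ y = (\<Sum>i\<in>B. if i = h then 1 else 0)"
      using entry_unique[OF that(2,3)] sub[OF that(1)] by (auto intro!: sum.cong)
    then show ?thesis using fin[OF that(1)] by simp
  qed
  define rep where "rep B = (SOME h. h \<in> B)" for B :: "'i set"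
  have rep: "rep B \<in> B" if "B \<in> P" for B
    using P that unfolding rep_def partition_on_def by (metis some_in_eq)
  define q where "q S T B = (\<Sum>a\<in>S. \<Sum>b\<in>T. p a b (rep B))" for S T B
  have nz: "(\<Sum>i\<in>B. A i) \<noteq> 0" if "B \<in> P" for B
  proof -
    have rI: "rep B \<in> I" using rep[OF that] sub[OF that] by blast
    obtain x y where "A (rep B) $ x $ y = 1" using relation_nonempty[OF rI] by blast
    then have "(\<Sum>i\<in>B. A i) $ x $ y = 1" using ent[OF that rI] rep[OF that] by simp
    then show ?thesis by (metis zero_index zero_neq_one)
  qed
  have e01: "(\<Sum>i\<in>B. A i) $ x $ y \<in> {0, 1}" if "B \<in> P" for B x y
  proof -
    obtain h where "h \<in> I" "A h $ x $ y = 1" using relation_exists by blast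
    then show ?thesis using ent[OF that] by simp
  qed
  have total: "(\<Sum>B\<in>P. \<Sum>i\<in>B. A i) = (\<chi> x y. 1)"
  proof -
    have "(\<Sum>B\<in>P. \<Sum>i\<in>B. A i) = (\<Sum>i\<in>\<Union>P. A i)"
      using P fin by (subst sum.Union_disjoint) (auto simp: partition_on_def disjoint_def)
    also have "\<Union>P = I" using P by (simp add: partition_on_def)
    finally show ?thesis using scheme by (simp add: symmetric_scheme_def)
  qed
  have trans: "transpose (\<Sum>i\<in>B. A i) = (\<Sum>i\<in>B. A i)" if "B \<in> P" for B
    using sub[OF that] entry_sym
    by (auto simp: vec_eq_iff transpose_def intro!: sum.cong)
  have mult: "(\<Sum>i\<in>S. A i) ** (\<Sum>i\<in>T. A i) = (\<Sum>B\<in>P. q S T B *\<^sub>R (\<Sum>i\<in>B. A i))"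
    if S: "S \<in> P" and T: "T \<in> P" for S T
  proof -
    have "((\<Sum>i\<in>S. A i) ** (\<Sum>i\<in>T. A i)) $ x $ y = (\<Sum>B\<in>P. q S T B *\<^sub>R (\<Sum>i\<in>B. A i)) $ x $ y"
      for x y
    proof -
      obtain h where h: "h \<in> I" "A h $ x $ y = 1" using relation_exists by blast
      then obtain C where C: "C \<in> P" "h \<in> C" using P by (auto simp: partition_on_def)
      have in_block: "h \<in> B \<longleftrightarrow> B = C" if "B \<in> P" for B
        using P C that by (auto simp: partition_on_def disjoint_def)
      have "((\<Sum>i\<in>S. A i) ** (\<Sum>i\<in>T. A i)) $ x $ y = (\<Sum>a\<in>S. \<Sum>b\<in>T. (A a ** A b) $ x $ y)"
      proof -
        have "((\<Sum>i\<in>S. A i) ** (\<Sum>i\<in>T. A i)) $ x $ y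
            = (\<Sum>w\<in>UNIV. \<Sum>a\<in>S. \<Sum>b\<in>T. A a $ x $ w * A b $ w $ y)"
          by (simp add: matrix_matrix_mult_def sum_product)
        also have "\<dots> = (\<Sum>a\<in>S. \<Sum>w\<in>UNIV. \<Sum>b\<in>T. A a $ x $ w * A b $ w $ y)"
          by (rule sum.swap)
        also have "\<dots> = (\<Sum>a\<in>S. \<Sum>b\<in>T. \<Sum>w\<in>UNIV. A a $ x $ w * A b $ w $ y)"
          by (intro sum.cong refl sum.swap)
        finally show ?thesis by (simp add: matrix_matrix_mult_def)
      qed
      also have "\<dots> = (\<Sum>a\<in>S. \<Sum>b\<in>T. p a b h)"
        using product_entry[OF _ _ h] sub[OF S] sub[OF T] by (intro sum.cong refl) blast
      also have "\<dots> = q S T C"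
        unfolding q_def using const[OF S T C(1) C(2) rep[OF C(1)]] .
      also have "\<dots> = (\<Sum>B\<in>P. if B = C then q S T B else 0)"
        using finP C by simp
      also have "\<dots> = (\<Sum>B\<in>P. q S T B * (\<Sum>i\<in>B. A i) $ x $ y)"
        using ent[OF _ h] in_block by (intro sum.cong refl) (simp del: sum_component)
      finally show ?thesis by simp
    qed
    then show ?thesis by (simp add: vec_eq_iff)
  qed
  show ?thesis
    unfolding symmetric_scheme_def
    using finP zP nz e01 total trans mult A_z by auto
qed

section \<open>Uniform intersection numbers\<close>

text \<open>
  The normalisation by valencies turns the triangle count of \<open>p_triple\<close> into a fully symmetric
  function of the three relations.
\<close>

definition density :: "'i \<Rightarrow> 'i \<Rightarrow> 'i \<Rightarrow> real" where
  "density i j h = p i j h / (valency i * valency j)"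

lemma density_swap12:
  assumes "i \<in> I" "j \<in> I" "h \<in> I"
  shows "density i j h = density j i h"
  using p_commute[OF assms] by (simp add: density_def mult.commute)

lemma density_rotate:
  assumes "i \<in> I" "j \<in> I" "h \<in> I"
  shows "density i j h = density h i j"
proof -
  have "valency h * p i j h / (valency i * valency j * valency h)
      = valency j * p h i j / (valency i * valency j * valency h)"
    by (simp only: p_triple[OF assms])
  then show ?thesis
    using valency_pos[OF assms(2)] valency_pos[OF assms(3)]
    by (simp add: density_def mult.commute)
qed

lemma p_density:
  assumes "i \<in> I" "j \<in> I"
  shows "p i j h = density i j h * valency i * valency j"
  using valency_pos[OF assms(1)] valency_pos[OF assms(2)] by (simp add: density_def)

text \<open>
  Uniformity is the only consequence of the fusion of triples that enters the argument.  The three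
  nontrivial relations make the equations between pairs of relations rigid enough to force
  constants.
\<close>

context
  assumes uniform: "\<And>a b h k. \<lbrakk>a \<in> I - {z}; b \<in> I - {z}; h \<in> I - {z, a, b}; k \<in> I - {z, a, b}\<rbrakk>
      \<Longrightarrow> p a b h = p a b k"
    and three: "card (I - {z}) \<ge> 3"
begin

text \<open>
  Uniformity says that one index of a triple of distinct indices may be exchanged for another one,
  and by symmetry this holds in every position.  Bringing the target indices in one at a time
  connects any two triples; an index that is already present is only moved into place.
\<close>

lemma density_constant_on_distinct:
  assumes "{a, b, c} \<subseteq> I - {z}" "a \<noteq> b" "a \<noteq> c" "b \<noteq> c"
    and "{a', b', c'} \<subseteq> I - {z}" "a' \<noteq> b'" "a' \<noteq> c'" "b' \<noteq> c'"
  shows "density a b c = density a' b' c'"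
proof -
  have exch: "density u v w = density u v w'"
    if "{u, v, w, w'} \<subseteq> I - {z}" "u \<noteq> w" "v \<noteq> w" "u \<noteq> w'" "v \<noteq> w'" for u v w w'
    using uniform[of u v w w'] that by (simp add: density_def)
  have rot: "density u v w = density w u v" and swap: "density u v w = density v u w"
    and swap23: "density u v w = density u w v"
    if "{u, v, w} \<subseteq> I - {z}" for u v w
  proof -
    have I: "u \<in> I" "v \<in> I" "w \<in> I" using that by auto
    show "density u v w = density w u v" by (rule density_rotate[OF I])
    also have "\<dots> = density u w v" by (rule density_swap12[OF I(3,1,2)])
    finally show "density u v w = density u w v" .
    show "density u v w = density v u w" by (rule density_swap12[OF I])
  qed
  have "\<exists>u v. {u, v} \<subseteq> I - {z} \<and> distinct [a', u, v] \<and> density a b c = density a' u v"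
  proof -
    consider "a' = a" | "a' = b" | "a' = c" | "a' \<notin> {a, b, c}" by blast
    then show ?thesis
    proof cases
      case 1 then show ?thesis using assms by (intro exI[of _ b] exI[of _ c]) auto
    next
      case 2
      have "density a b c = density b a c" using assms by (intro swap) auto
      then show ?thesis using assms 2 by (intro exI[of _ a] exI[of _ c]) auto
    next
      case 3
      have "density a b c = density c a b" using assms by (intro rot) auto
      then show ?thesis using assms 3 by (intro exI[of _ a] exI[of _ b]) auto
    next
      case 4
      have "density a b c = density a b a'" using assms 4 by (intro exch) auto
      also have "\<dots> = density a' a b" using assms by (intro rot) auto
      finally show ?thesis using assms 4 by (intro exI[of _ a] exI[of _ b]) auto
    qed
  qed
  then obtain u v where uv: "{u, v} \<subseteq> I - {z}" "distinct [a', u, v]"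
    "density a b c = density a' u v" by blast
  have "\<exists>w. w \<in> I - {z} \<and> distinct [a', b', w] \<and> density a' u v = density a' b' w"
  proof -
    consider "b' = u" | "b' = v" | "b' \<notin> {u, v}" by blast
    then show ?thesis
    proof cases
      case 1 then show ?thesis using assms uv by (intro exI[of _ v]) auto
    next
      case 2
      have "density a' u v = density a' v u" using assms uv by (intro swap23) auto
      then show ?thesis using assms uv 2 by (intro exI[of _ u]) auto
    next
      case 3
      have "density a' u v = density a' u b'" using assms uv 3 by (intro exch) auto
      also have "\<dots> = density a' b' u" using assms uv by (intro swap23) auto
      finally show ?thesis using assms uv 3 by (intro exI[of _ u]) auto
    qed
  qed
  then obtain w where w: "w \<in> I - {z}" "distinct [a', b', w]" "density a' u v = density a' b' w"
    by blast
  have "density a' b' w = density a' b' c'" using assms w by (intro exch) auto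
  then show ?thesis using uv(3) w(3) by simp
qed

text \<open>
  Symmetry and uniformity of the density leave the unknowns \<open>l\<close> (distinct triples), \<open>m a\<close>
  (triples \<open>(a, a, h)\<close>) and \<open>p a a a\<close>.  The sums \<open>\<Sum>b. p a b h\<close> with \<open>h \<noteq> a\<close> tie the \<open>m a\<close>
  together through \<open>e\<close>, and those with \<open>h = a\<close> determine \<open>p a a a\<close>.  That the coefficient of
  \<open>of_bool (h = a)\<close> in the diagonal term is a constant \<open>t\<close>, and not a function of \<open>a\<close>, is what
  later makes the formula compatible with sums over blocks.
\<close>

lemma p_normal_form:
  obtains l e t where
    "\<And>a b h. \<lbrakk>a \<in> I - {z}; b \<in> I - {z}; h \<in> I - {z}\<rbrakk> \<Longrightarrow>
       p a b h = l * valency a * valency b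
         + e * (valency b * of_bool (h = a) + valency a * of_bool (h = b))
         + of_bool (a = b) * (e * valency a + t * of_bool (h = a))"
proof -
  let ?N = "I - {z}" and ?k = valency
  have fN: "finite ?N" using finite_I by simp
  obtain a0 b0 c0 where abc: "{a0, b0, c0} \<subseteq> ?N" "a0 \<noteq> b0" "a0 \<noteq> c0" "b0 \<noteq> c0"
  proof -
    obtain T where "T \<subseteq> ?N" "card T = 3" using three by (meson obtain_subset_with_card_n)
    then show ?thesis using that by (auto simp: card_3_iff)
  qed
  have third: "\<exists>c\<in>?N. c \<noteq> a \<and> c \<noteq> b" for a b
    using abc by (metis insert_subset)
  define l where "l = density a0 b0 c0"
  have l: "p a b h = l * ?k a * ?k b" if "{a, b, h} \<subseteq> ?N" "a \<noteq> b" "a \<noteq> h" "b \<noteq> h" for a b h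
    using density_constant_on_distinct[OF that abc] p_density[of a b h] that by (simp add: l_def)
  \<comment> \<open>Uniformity makes the value at \<open>(a, a, h)\<close> independent of \<open>h \<noteq> a\<close>, so any fixed choice of
    \<open>h\<close> defines it.\<close>
  define other where "other a = (SOME h. h \<in> ?N \<and> h \<noteq> a)" for a
  have other: "other a \<in> ?N \<and> other a \<noteq> a" for a
    unfolding other_def by (rule someI_ex) (use third in blast)
  define m where "m a = density a a (other a)" for a
  have m: "p a a h = m a * ?k a * ?k a" if "a \<in> ?N" "h \<in> ?N" "h \<noteq> a" for a h
    using uniform[of a a h "other a"] other[of a] that p_density[of a a "other a"]
    by (simp add: m_def)
  have m1: "p a b a = m a * ?k a * ?k b" if "a \<in> ?N" "b \<in> ?N" "b \<noteq> a" for a b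
  proof -
    have "density a b a = density a a b" using density_rotate[of a b a] that by simp
    then show ?thesis using m[OF that] p_density[of a b a] p_density[of a a b] valency_pos[of a] that by simp
  qed
  have m2: "p a b b = m b * ?k a * ?k b" if "a \<in> ?N" "b \<in> ?N" "b \<noteq> a" for a b
    using m1[of b a] p_commute[of a b b] that by simp
  define K where "K = (\<Sum>b\<in>?N. ?k b)"
  have split: "(\<Sum>b\<in>?N. p a b h) = ?k a - of_bool (a = h)" if "a \<in> ?N" "h \<in> ?N" for a h
    using sum_p[of a h] that sum.remove[OF finite_I z_in_I, of "\<lambda>b. p a b h"]
      p_commute[of a z h] p_left_z[of a h] z_in_I by (auto simp: algebra_simps)
  define x where "x a = (m a - l) * ?k a" for a
  have pair: "x a + x h = 1 - l * K" if "a \<in> ?N" "h \<in> ?N" "a \<noteq> h" for a h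
  proof -
    have "(\<Sum>b\<in>?N. p a b h) = p a a h + (p a h h + (\<Sum>b\<in>?N - {a} - {h}. p a b h))"
      using that fN by (subst sum.remove[of _ a], simp, simp, subst sum.remove[of _ h]) auto
    also have "(\<Sum>b\<in>?N - {a} - {h}. p a b h) = (\<Sum>b\<in>?N - {a} - {h}. l * ?k a * ?k b)"
      using l that by (intro sum.cong) auto
    also have "\<dots> = l * ?k a * (\<Sum>b\<in>?N - {a} - {h}. ?k b)" by (simp add: sum_distrib_left)
    also have "(\<Sum>b\<in>?N - {a} - {h}. ?k b) = K - ?k a - ?k h"
      using that fN by (simp add: K_def sum_diff1)
    finally have "?k a = m a * ?k a * ?k a + (m h * ?k a * ?k h + l * ?k a * (K - ?k a - ?k h))"
      using split[OF that(1,2)] m[of a h] m2[of a h] that by simp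
    then have "?k a * (x a + x h) = ?k a * (1 - l * K)" by (simp add: x_def algebra_simps)
    then show ?thesis using valency_pos[of a] that by simp
  qed
  define e where "e = (1 - l * K) / 2"
  \<comment> \<open>Three pairwise sums that are all \<open>2 * e\<close> force the three summands to be \<open>e\<close>.\<close>
  have x: "x a = e" if a: "a \<in> ?N" for a
  proof -
    obtain b where b: "b \<in> ?N" "b \<noteq> a" using third[of a a] by blast
    obtain c where c: "c \<in> ?N" "c \<noteq> a" "c \<noteq> b" using third by blast
    show ?thesis using pair[of a b] pair[of a c] pair[of b c] a b c by (simp add: e_def)
  qed
  have mk: "m a * ?k a = l * ?k a + e" if "a \<in> ?N" for a
    using x[OF that] by (simp add: x_def algebra_simps)
  \<comment> \<open>In \<open>p a a a\<close> the terms proportional to \<open>k a\<close> combine to \<open>3 * e * k a\<close>, by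
    \<open>1 - l * K = 2 * e\<close>; three such terms occur in the normal form at \<open>a = b = h\<close>, and \<open>t\<close> is
    what remains.\<close>
  define t where "t = - 1 - e * K"
  have paa: "p a a a = l * ?k a * ?k a + 3 * e * ?k a + t" if "a \<in> ?N" for a
  proof -
    have "(\<Sum>b\<in>?N. p a b a) = p a a a + (\<Sum>b\<in>?N - {a}. p a b a)"
      using that fN by (subst sum.remove[of _ a]) auto
    also have "(\<Sum>b\<in>?N - {a}. p a b a) = (\<Sum>b\<in>?N - {a}. m a * ?k a * ?k b)"
      using m1 that by (intro sum.cong) auto
    also have "\<dots> = m a * ?k a * (K - ?k a)"
      using that fN by (simp add: K_def sum_diff1 sum_distrib_left[symmetric])
    finally have "p a a a = ?k a - 1 - (l * ?k a + e) * (K - ?k a)"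
      using split[of a a] mk[OF that] that by simp
    also have "\<dots> = (1 - l * K) * ?k a + l * ?k a * ?k a + e * ?k a - 1 - e * K"
      by (simp add: algebra_simps)
    also have "1 - l * K = 2 * e" by (simp add: e_def)
    finally show ?thesis by (simp add: t_def)
  qed
  show ?thesis
  proof (rule that[of l e t])
    fix a b h assume *: "a \<in> ?N" "b \<in> ?N" "h \<in> ?N"
    consider "a = b" "h = a" | "a = b" "h \<noteq> a" | "a \<noteq> b" "h = a" | "a \<noteq> b" "h = b"
      | "a \<noteq> b" "h \<noteq> a" "h \<noteq> b" by blast
    then show "p a b h = l * ?k a * ?k b
         + e * (?k b * of_bool (h = a) + ?k a * of_bool (h = b))
         + of_bool (a = b) * (e * ?k a + t * of_bool (h = a))"
    proof cases
      case 1 then show ?thesis using paa * by (simp add: algebra_simps)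
    next
      case 2
      then have "p a b h = (l * ?k a + e) * ?k a" using m[of a h] mk[of a] * by simp
      then show ?thesis using 2 by (simp add: algebra_simps)
    next
      case 3
      then have "p a b h = (l * ?k a + e) * ?k b" using m1[of a b] mk[of a] * by simp
      then show ?thesis using 3 by (simp add: algebra_simps)
    next
      case 4
      then have "p a b h = (m b * ?k b) * ?k a" using m2[of a b] * by simp
      also have "m b * ?k b = l * ?k b + e" using mk * by blast
      finally show ?thesis using 4 by (simp add: algebra_simps)
    next
      case 5 then show ?thesis using l[of a b h] * by simp
    qed
  qed
qed

text \<open>
  Summing the normal form over \<open>a \<in> S\<close> and \<open>b \<in> T\<close> leaves an expression in which \<open>h\<close> occurs only
  through \<open>h \<in> S\<close> and \<open>h \<in> T\<close>, hence only through its block.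
\<close>

lemma every_partition_fuses:
  assumes P: "partition_on I P" and zP: "{z} \<in> P"
  shows "symmetric_scheme P {z} (\<lambda>B. \<Sum>i\<in>B. A i)"
proof (rule fusion_scheme_if_block_sums_constant[OF P zP])
  fix S T B h h'
  assume S: "S \<in> P" and T: "T \<in> P" and B: "B \<in> P" and h: "h \<in> B" and h': "h' \<in> B"
  have sub: "C \<subseteq> I" if "C \<in> P" for C using P that by (auto simp: partition_on_def)
  have same: "h \<in> C \<longleftrightarrow> h' \<in> C" if "C \<in> P" for C
    using P B h h' that by (auto simp: partition_on_def disjoint_def)
  have trivial_block: "C = {z}" if "C \<in> P" "z \<in> C" for C
    using partition_onD2[OF P] disjointD[of P "{z}" C] zP that by blast
  have fin: "finite C" if "C \<in> P" for C using sub[OF that] finite_I finite_subset by blast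
  have hI: "h \<in> I" "h' \<in> I" using h h' sub[OF B] by auto
  show "(\<Sum>a\<in>S. \<Sum>b\<in>T. p a b h) = (\<Sum>a\<in>S. \<Sum>b\<in>T. p a b h')"
  proof -
    consider "S = {z}" | "T = {z}" | "B = {z}" | "z \<notin> S" "z \<notin> T" "z \<notin> B"
      using trivial_block S T B by blast
    then show ?thesis
    proof cases
      case 1
      have "(\<Sum>a\<in>S. \<Sum>b\<in>T. p a b g) = of_bool (g \<in> T)" if "g \<in> I" for g
      proof -
        have "(\<Sum>b\<in>T. p z b g) = (\<Sum>b\<in>T. if b = g then 1 else 0)"
          using p_left_z that sub[OF T] by (intro sum.cong) auto
        then show ?thesis using 1 fin[OF T] by simp
      qed
      then show ?thesis using same[OF T] hI by simp
    next
      case 2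
      have "(\<Sum>a\<in>S. \<Sum>b\<in>T. p a b g) = of_bool (g \<in> S)" if "g \<in> I" for g
      proof -
        have "(\<Sum>a\<in>S. p a z g) = (\<Sum>a\<in>S. if a = g then 1 else 0)"
          using p_left_z p_commute[OF _ z_in_I] that sub[OF S] by (intro sum.cong) auto
        then show ?thesis using 2 fin[OF S] by simp
      qed
      then show ?thesis using same[OF S] hI by simp
    next
      case 3 then show ?thesis using h h' by simp
    next
      case 4
      obtain l e t where nf: "\<And>a b h. \<lbrakk>a \<in> I - {z}; b \<in> I - {z}; h \<in> I - {z}\<rbrakk> \<Longrightarrow>
         p a b h = l * valency a * valency b
         + e * (valency b * of_bool (h = a) + valency a * of_bool (h = b))
         + of_bool (a = b) * (e * valency a + t * of_bool (h = a))"
        using p_normal_form by blast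
      let ?k = valency
      have "(\<Sum>a\<in>S. \<Sum>b\<in>T. p a b g)
          = l * sum ?k S * sum ?k T + e * (sum ?k T * of_bool (g \<in> S) + sum ?k S * of_bool (g \<in> T))
            + (e * sum ?k (S \<inter> T) + t * of_bool (g \<in> S \<and> g \<in> T))" if "g \<in> B" for g
      proof -
        have "(\<Sum>a\<in>S. \<Sum>b\<in>T. p a b g) = (\<Sum>a\<in>S. \<Sum>b\<in>T. l * ?k a * ?k b
              + e * (?k b * of_bool (g = a) + ?k a * of_bool (g = b))
              + of_bool (a = b) * (e * ?k a + t * of_bool (g = a)))"
          using nf that 4 sub[OF S] sub[OF T] sub[OF B] by (intro sum.cong refl) blast
        also have "\<dots> = (\<Sum>a\<in>S. \<Sum>b\<in>T. l * ?k a * ?k b)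
            + (\<Sum>a\<in>S. \<Sum>b\<in>T. e * (?k b * of_bool (g = a) + ?k a * of_bool (g = b)))
            + (\<Sum>a\<in>S. \<Sum>b\<in>T. of_bool (a = b) * (e * ?k a + t * of_bool (g = a)))"
          by (simp add: sum.distrib)
        also have "(\<Sum>a\<in>S. \<Sum>b\<in>T. l * ?k a * ?k b) = l * sum ?k S * sum ?k T"
          by (simp add: sum_distrib_left[symmetric] sum_distrib_right[symmetric])
        also have "(\<Sum>a\<in>S. \<Sum>b\<in>T. e * (?k b * of_bool (g = a) + ?k a * of_bool (g = b)))
            = e * (sum ?k T * (\<Sum>a\<in>S. of_bool (g = a)) + sum ?k S * (\<Sum>b\<in>T. of_bool (g = b)))"
          by (simp add: sum_distrib_left[symmetric] sum_distrib_right[symmetric] sum.distrib)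
        also have "(\<Sum>a\<in>S. of_bool (g = a)) = (of_bool (g \<in> S) :: real)"
          using fin[OF S] by (simp add: of_bool_def)
        also have "(\<Sum>b\<in>T. of_bool (g = b)) = (of_bool (g \<in> T) :: real)"
          using fin[OF T] by (simp add: of_bool_def)
        also have "(\<Sum>a\<in>S. \<Sum>b\<in>T. of_bool (a = b) * (e * ?k a + t * of_bool (g = a)))
            = (\<Sum>a\<in>S. if a \<in> T then e * ?k a + t * of_bool (g = a) else 0)"
          using fin[OF T] by (intro sum.cong refl) (simp add: of_bool_def if_distrib[of "\<lambda>u. u * _"] cong: if_cong)
        also have "\<dots> = (\<Sum>a\<in>S \<inter> T. e * ?k a + t * of_bool (g = a))"
          using fin[OF S] by (simp add: sum.inter_restrict)
        also have "\<dots> = e * sum ?k (S \<inter> T) + t * (\<Sum>a\<in>S \<inter> T. of_bool (g = a))"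
          by (simp add: sum.distrib sum_distrib_left)
        also have "(\<Sum>a\<in>S \<inter> T. of_bool (g = a)) = (of_bool (g \<in> S \<and> g \<in> T) :: real)"
          using fin[OF S] by (simp add: of_bool_def)
        finally show ?thesis .
      qed
      then show ?thesis using same[OF S] same[OF T] h h' by simp
    qed
  qed
qed

end

end

section \<open>Fusing triples\<close>

lemma product_entry_constant:
  assumes "symmetric_scheme I z A" "i \<in> I" "j \<in> I" "h \<in> I" "A h $ x $ y = 1" "A h $ x' $ y' = 1"
  shows "(A i ** A j) $ x $ y = (A i ** A j) $ x' $ y'"
proof -
  obtain p where "scheme_with_numbers I z A p"
    using assms(1) unfolding symmetric_scheme_def scheme_with_numbers_def by blast
  then interpret scheme_with_numbers I z A p .
  show ?thesis
    using product_entry[OF assms(2-5)] product_entry[OF assms(2-4) assms(6)] by simp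
qed

text \<open>
  Relations outside \<open>F\<close> stay relations of the fused scheme, so their product is constant on the
  single fused relation that contains both \<open>h\<close> and \<open>k\<close>.
\<close>

lemma fuses_imp_numbers_agree:
  assumes sc: "scheme_with_numbers {0..d} 0 A p" and F: "fuses d A F" "F \<subseteq> {0..d}"
    and ab: "a \<in> {0..d} - F" "b \<in> {0..d} - F" and hk: "h \<in> F" "k \<in> F"
  shows "p a b h = p a b k"
proof -
  interpret scheme_with_numbers "{0..d}" 0 A p by fact
  let ?P = "insert F ((\<lambda>i. {i}) ` ({0..d} - F))"
  have fin: "finite F" using F(2) finite_subset by blast
  have one: "(\<Sum>i\<in>F. A i) $ x $ y = 1" if "A g $ x $ y = 1" "g \<in> F" for g x y
  proof -
    have "(\<Sum>i\<in>F. A i) $ x $ y = (\<Sum>i\<in>F. if i = g then 1 else 0)"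
      unfolding sum_component
      using entry_unique[OF _ that(1)] that(2) F(2) by (intro sum.cong refl) blast
    then show ?thesis using fin that by simp
  qed
  obtain x y where xy: "A h $ x $ y = 1" using relation_nonempty hk F(2) by blast
  obtain x' y' where xy': "A k $ x' $ y' = 1" using relation_nonempty hk F(2) by blast
  have "symmetric_scheme ?P {0} (\<lambda>B. \<Sum>i\<in>B. A i)"
    using F(1) by (simp add: fuses_def is_fusion_scheme_def)
  from product_entry_constant[OF this, of "{a}" "{b}" F x y x' y']
  have "(A a ** A b) $ x $ y = (A a ** A b) $ x' $ y'"
    using ab one[OF xy hk(1)] one[OF xy' hk(2)] by simp
  then show ?thesis
    using product_entry[OF _ _ _ xy, of a b] product_entry[OF _ _ _ xy', of a b] ab
      subsetD[OF F(2) hk(1)] subsetD[OF F(2) hk(2)] by auto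
qed

theorem corollary1p4:
  fixes d :: nat and A :: "nat \<Rightarrow> real ^ 'x ^ 'x"
  assumes "d \<ge> 5"
    and "symmetric_class_scheme d A"
    and "\<And>i j k. \<lbrakk>i \<in> {1..d}; j \<in> {1..d}; k \<in> {1..d}; i \<noteq> j; j \<noteq> k; i \<noteq> k\<rbrakk>
           \<Longrightarrow> fuses d A {i, j, k}"
  shows "amorphic d A"
proof -
  obtain p where sc: "scheme_with_numbers {0..d} 0 A p"
    using assms(2) unfolding symmetric_scheme_def scheme_with_numbers_def by blast
  have nontrivial: "{0..d} - {0} = {1..d}" by auto
  have uniform: "p a b h = p a b k"
    if "a \<in> {0..d} - {0}" "b \<in> {0..d} - {0}" "h \<in> {0..d} - {0, a, b}" "k \<in> {0..d} - {0, a, b}"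
    for a b h k
  proof (cases "h = k")
    case False
    \<comment> \<open>A fifth nontrivial relation completes \<open>h\<close>, \<open>k\<close> to a triple avoiding \<open>a\<close>, \<open>b\<close>.\<close>
    have "card {a, b, h, k} \<le> 4" by (simp add: card_insert_if)
    then have "card {a, b, h, k} < card {1..d}" using assms(1) by simp
    then obtain g where g: "g \<in> {1..d}" "g \<notin> {a, b, h, k}"
      by (meson card_mono finite.emptyI finite.insertI not_le subsetI)
    have "fuses d A {h, k, g}" using assms(3)[of h k g] g that False by auto
    then show ?thesis
      using fuses_imp_numbers_agree[OF sc, of "{h, k, g}" a b h k] g that by auto
  qed simp
  have "card ({0..d} - {0}) \<ge> 3" using assms(1) by (simp add: nontrivial)
  from scheme_with_numbers.every_partition_fuses[OF sc uniform this]
  show ?thesis by (auto simp: amorphic_def fusion_partition_def is_fusion_scheme_def)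
qed

end
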